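(* There is a relation $\preccurlyeq\,\in\mathscr{L}^1_{\mathbb Z}$ that is not positive syntactic.
   Context: $\mathbb Z\text{-}\mathrm{Mod}$ is the class of all abelian groups, viewed as structures in the language of $\mathbb Z$-modules. $A\leq B$ means subgroup, $A\leq_\oplus B$ means direct summand. AEC: a pair $\mathcal K=(\mathbf K,\preccurlyeq)$, with $\mathbf K$ a class of $L$-structures and $\preccurlyeq$ a binary relation on $\mathbf K$, such that: (i) $\mathbf K$ and $\preccurlyeq$ are closed under isomorphisms; (ii) $A\preccurlyeq B$ implies $A$ is a substructure of $B$; (iii) $\preccurlyeq$ is a partial order; (iv) if $(A_i)_{i<\delta}$ ($\delta$ limit) is an increasing continuous $\preccurlyeq$-chain in $\mathbf K$, then $A=\bigcup_{i<\delta}A_i\in\mathbf K$, $A_j\preccurlyeq A$ for all $j<\delta$, and if $A_i\preccurlyeq B$ for all $i<\delta$ then $A\preccurlyeq B$; (v) if $A\preccurlyeq C$, $B\preccurlyeq C$ and $A$ is a substructure of $B$ then $A\preccurlyeq B$; (vi) there is a cardinal $\lambda\geq|L|+\aleph_0$ such that for all $B\in\mathbf K$, $X\subseteq B$ there is $A\in\mathbf K$ with $X\subseteq A\preccurlyeq B$ and $|A|\leq|X|+\lambda$. $\mathscr{L}_{\mathbb Z}$ is the class of all binary relations $\preccurlyeq$ on $\mathbb Z\text{-}\mathrm{Mod}$ such that $(\mathbb Z\text{-}\mathrm{Mod},\preccurlyeq)$ is an AEC and $A\leq_\oplus B$ implies $A\preccurlyeq B$, ordered by reverse inclusion. Purity: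 $A\leq_{\mathrm{pp}}B$ iff $A\leq B$ and every finite system of $\mathbb Z$-linear equations with right-hand side in $A$ solvable in $B$ is solvable in $A$. $\mathscr{L}^1_{\mathbb Z}=\{\preccurlyeq\,\in\mathscr L_{\mathbb Z}\mid\ \leq_{\mathrm{pp}}\subseteq\preccurlyeq\}$. Infinitary pp-formulas (with $R=\mathbb Z$): for infinite cardinals $\lambda\leq\kappa$, ordinals $\epsilon<\lambda$ and ordinals $\alpha$, the set $\Lambda^{\kappa,\lambda}_{\alpha,\epsilon}$ of formulas in free variables $\bar x$, $|\bar x|=\epsilon$, is defined by induction on $\alpha$: $\Lambda^{\kappa,\lambda}_{0,\epsilon}$ is the set of equations $\sum_{\zeta<\epsilon}r_\zeta x_\zeta=0$ with $r_\zeta\in R$, finitely many nonzero; for $\alpha$ limit, $\Lambda^{\kappa,\lambda}_{\alpha,\epsilon}=\bigcup_{\beta<\alpha}\Lambda^{\kappa,\lambda}_{\beta,\epsilon}$; $\Lambda^{\kappa,\lambda}_{\beta+1,\epsilon}$ is the set of formulas $\exists\bar y\bigwedge\Psi$ with $|\bar y|=\zeta<\lambda$ ($\zeta=0$ allowed) and $\Psi\subseteq\Lambda^{\kappa,\lambda}_{\beta,\epsilon+\zeta}$, $|\Psi|<\kappa$. $\Lambda^{\infty,\infty}_\infty$ is the union of all $\Lambda^{\kappa,\lambda}_{\alpha,\epsilon}$ over all $\kappa,\lambda,\alpha,\epsilon$. For $\Sigma\subseteq\Lambda^{\infty,\infty}_\infty$, $A\leq_\Sigma B$ iff $A\leq B$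 and for all $\varphi(\bar x)\in\Sigma$, $\bar a\in A^{|\bar x|}$: $A\models\varphi(\bar a)\Leftrightarrow B\models\varphi(\bar a)$. A relation $\preccurlyeq$ is positive syntactic if $\preccurlyeq\,=\,\leq_\Sigma$ for some $\Sigma\subseteq\Lambda^{\infty,\infty}_\infty$. *)

theory Defs
  imports "HOL-Algebra.Coset" "HOL-Algebra.FiniteProduct"
begin

unbundle cardinal_syntax

section \<open>The universe\<close>

text \<open>
  HOL has no proper classes, so everything is relative to a type \<open>'u\<close> whose cardinality \<open>\<Omega>\<close>
  plays the role of the cardinality of the universe: ``class'' means an arbitrary HOL set,
  ``set'' means smaller than \<open>\<Omega>\<close>.  The well-order of \<open>'u\<close> has order type \<open>\<Omega>\<close>, so the elements
  of \<open>'u\<close> are the ordinals of the universe (von Neumann style: \<open>a\<close> stands for \<open>{..<a}\<close>); they also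
  serve as the elements of the underlying sets of groups.

  If \<open>\<Omega>\<close> is inaccessible, this is the usual Grothendieck universe of sets of rank below \<open>\<Omega>\<close>, up to
  isomorphism of the groups involved.  Only the closure properties actually needed are
  required (uncountability, regularity), not that \<open>\<Omega>\<close> is a strong limit; so a
  theorem about all such \<open>'u\<close> covers in particular all Grothendieck universes, while
  its hypothesis is satisfiable in HOL, e.g. by the type of countable ordinals.
\<close>

definition set_universe :: "'u::wellorder itself \<Rightarrow> bool" where
  "set_universe _ \<longleftrightarrow>
     natLeq <o |UNIV :: 'u set| \<and>
     regularCard |UNIV :: 'u set| \<and>
     (\<forall>a::'u. |{..<a}| <o |UNIV :: 'u set| )"

definition small :: "'u set \<Rightarrow> bool" where
  "small X \<longleftrightarrow> |X| <o |UNIV :: 'u set|"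

definition zero_ord :: "'u::wellorder \<Rightarrow> bool" where
  "zero_ord a \<longleftrightarrow> (\<forall>b. a \<le> b)"

definition succ_ord :: "'u::wellorder \<Rightarrow> 'u \<Rightarrow> bool" where
  "succ_ord b a \<longleftrightarrow> b < a \<and> (\<forall>c. b < c \<longrightarrow> a \<le> c)"

definition limit_ord :: "'u::wellorder \<Rightarrow> bool" where
  "limit_ord a \<longleftrightarrow> (\<exists>b. b < a) \<and> (\<forall>b<a. \<exists>c. b < c \<and> c < a)"

definition infinite_card :: "'u::wellorder \<Rightarrow> bool" where
  "infinite_card c \<longleftrightarrow> infinite {..<c} \<and> (\<forall>a<c. |{..<a}| <o |{..<c}| )"


section \<open>Abelian groups\<close>

text \<open>
  Abelian groups are the commutative groups of \<open>HOL-Algebra\<close>, hence written multiplicatively: the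
  scalar multiple \<open>r \<cdot> x\<close> is the power \<open>x [^] r\<close> with \<open>r :: int\<close>.  The multiplication is required
  to be \<open>undefined\<close> off the carrier, so that two records are equal iff they are the same structure.
  Zero, negation and scalar multiplication are determined by the group operation, so homomorphisms
  and substructures in the language of Z-modules are group homomorphisms and subgroups.
\<close>

definition ZMod :: "'u monoid set" where
  "ZMod = {A. comm_group A \<and> small (carrier A) \<and>
     (\<forall>x y. \<not> (x \<in> carrier A \<and> y \<in> carrier A) \<longrightarrow> x \<otimes>\<^bsub>A\<^esub> y = undefined)}"

definition sub_structure :: "'u monoid \<Rightarrow> 'u monoid \<Rightarrow> bool" where
  "sub_structure A B \<longleftrightarrow> subgroup (carrier A) B \<and>
     (\<forall>x\<in>carrier A. \<forall>y\<in>carrier A. x \<otimes>\<^bsub>A\<^esub> y = x \<otimes>\<^bsub>B\<^esub> y)"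

definition direct_summand :: "'u monoid \<Rightarrow> 'u monoid \<Rightarrow> bool" where
  "direct_summand A B \<longleftrightarrow> sub_structure A B \<and>
     (\<exists>C\<in>ZMod. sub_structure C B \<and> carrier A \<inter> carrier C = {\<one>\<^bsub>B\<^esub>} \<and>
        carrier A <#>\<^bsub>B\<^esub> carrier C = carrier B)"

text \<open>The system has \<open>m\<close> equations in \<open>n\<close> unknowns, coefficients \<open>r\<close> and right-hand side \<open>a\<close>.\<close>

definition solvable_in ::
    "'u monoid \<Rightarrow> nat \<Rightarrow> nat \<Rightarrow> (nat \<Rightarrow> nat \<Rightarrow> int) \<Rightarrow> (nat \<Rightarrow> 'u) \<Rightarrow> bool" where
  "solvable_in A m n r a \<longleftrightarrow>
     (\<exists>x. (\<forall>j<n. x j \<in> carrier A) \<and>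
          (\<forall>i<m. (\<Otimes>\<^bsub>A\<^esub>j\<in>{..<n}. x j [^]\<^bsub>A\<^esub> r i j) = a i))"

definition pure_in :: "'u monoid \<Rightarrow> 'u monoid \<Rightarrow> bool" where
  "pure_in A B \<longleftrightarrow> sub_structure A B \<and>
     (\<forall>m n r a. (\<forall>i<m. a i \<in> carrier A) \<longrightarrow> solvable_in B m n r a \<longrightarrow> solvable_in A m n r a)"


section \<open>Abstract elementary classes of abelian groups\<close>

text \<open>The union of the chain \<open>(A i)\<^sub>i\<^sub><\<^sub>\<delta>\<close>; \<open>LEAST i. True\<close> is the ordinal 0.\<close>

definition chain_Union :: "('u::wellorder \<Rightarrow> 'u monoid) \<Rightarrow> 'u \<Rightarrow> 'u monoid" where
  "chain_Union A \<delta> =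
     \<lparr>carrier = (\<Union>i\<in>{..<\<delta>}. carrier (A i)),
      mult = (\<lambda>x y. if \<exists>i<\<delta>. x \<in> carrier (A i) \<and> y \<in> carrier (A i)
                    then x \<otimes>\<^bsub>A (LEAST i. x \<in> carrier (A i) \<and> y \<in> carrier (A i))\<^esub> y
                    else undefined),
      one = \<one>\<^bsub>A (LEAST i. True)\<^esub>\<rparr>"

definition continuous_chain ::
    "('u::wellorder monoid \<times> 'u monoid) set \<Rightarrow> 'u \<Rightarrow> ('u \<Rightarrow> 'u monoid) \<Rightarrow> bool" where
  "continuous_chain R \<delta> A \<longleftrightarrow>
     (\<forall>i j. i \<le> j \<longrightarrow> j < \<delta> \<longrightarrow> (A i, A j) \<in> R) \<and>
     (\<forall>i<\<delta>. limit_ord i \<longrightarrow> A i = chain_Union A i)"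

text \<open>
  The language of Z-modules is countable, so the bound on the cardinal in the last clause
  (represented by a small set \<open>S\<close> of that cardinality) is \<open>\<aleph>\<^sub>0\<close>.
\<close>

definition AEC :: "'u::wellorder monoid set \<Rightarrow> ('u monoid \<times> 'u monoid) set \<Rightarrow> bool" where
  "AEC K R \<longleftrightarrow> K \<subseteq> ZMod \<and>
     (\<forall>A\<in>K. \<forall>A'\<in>ZMod. A \<cong> A' \<longrightarrow> A' \<in> K) \<and>
     (\<forall>A\<in>K. \<forall>B\<in>K. \<forall>A'\<in>K. \<forall>B'\<in>K. \<forall>f.
        (A, B) \<in> R \<longrightarrow> f \<in> iso B B' \<longrightarrow> f \<in> iso A A' \<longrightarrow> (A', B') \<in> R) \<and>
     (\<forall>(A, B)\<in>R. sub_structure A B) \<and>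
     partial_order_on K R \<and>
     (\<forall>\<delta> A. limit_ord \<delta> \<longrightarrow> (\<forall>i<\<delta>. A i \<in> K) \<longrightarrow> continuous_chain R \<delta> A \<longrightarrow>
        chain_Union A \<delta> \<in> K \<and>
        (\<forall>j<\<delta>. (A j, chain_Union A \<delta>) \<in> R) \<and>
        (\<forall>B\<in>K. (\<forall>i<\<delta>. (A i, B) \<in> R) \<longrightarrow> (chain_Union A \<delta>, B) \<in> R)) \<and>
     (\<forall>A\<in>K. \<forall>B\<in>K. \<forall>C\<in>K.
        (A, C) \<in> R \<longrightarrow> (B, C) \<in> R \<longrightarrow> sub_structure A B \<longrightarrow> (A, B) \<in> R) \<and>
     (\<exists>S::'u set. small S \<and> natLeq \<le>o |S| \<and>
        (\<forall>B\<in>K. \<forall>X. X \<subseteq> carrier B \<longrightarrow>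
           (\<exists>A\<in>K. X \<subseteq> carrier A \<and> (A, B) \<in> R \<and> |carrier A| \<le>o |X| +c |S| )))"

definition LZ :: "('u::wellorder monoid \<times> 'u monoid) set set" where
  "LZ = {R. AEC ZMod R \<and>
     (\<forall>A\<in>ZMod. \<forall>B\<in>ZMod. direct_summand A B \<longrightarrow> (A, B) \<in> R)}"

definition LZ1 :: "('u::wellorder monoid \<times> 'u monoid) set set" where
  "LZ1 = {R \<in> LZ. \<forall>A\<in>ZMod. \<forall>B\<in>ZMod. pure_in A B \<longrightarrow> (A, B) \<in> R}"


section \<open>Infinitary pp-formulas\<close>

text \<open>
  The first argument of either constructor is the length \<open>\<epsilon>\<close> of the tuple of free variables
  \<open>(x\<^sub>\<xi>)\<^sub>\<xi>\<^sub><\<^sub>\<epsilon>\<close>.  \<open>Eqn \<epsilon> r\<close> is the equation with coefficients \<open>r\<close>.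
  \<open>ExConj \<epsilon> \<epsilon>' I \<psi>\<close> is \<open>\<exists>y. \<And>\<Psi>\<close> with \<open>\<Psi> = {\<psi> i | i \<in> I}\<close>; the bound tuple \<open>y\<close> of length \<open>\<zeta>\<close> is
  \<open>(x\<^sub>\<xi>)\<close> for \<open>\<epsilon> \<le> \<xi> < \<epsilon>'\<close>, where \<open>\<epsilon>' = \<epsilon> + \<zeta>\<close>.  Instead of \<open>\<zeta>\<close> we record \<open>\<epsilon>'\<close>: for
  \<open>\<epsilon> < \<lambda>\<close> with \<open>\<lambda>\<close> an infinite cardinal, the ordinals \<open>\<epsilon> + \<zeta>\<close> with \<open>\<zeta> < \<lambda>\<close> are exactly the
  \<open>\<epsilon>'\<close> with \<open>\<epsilon> \<le> \<epsilon>' < \<lambda>\<close>.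
\<close>

datatype 'u ppf =
    Eqn 'u "'u \<Rightarrow> int"
  | ExConj 'u 'u "'u set" "'u \<Rightarrow> 'u ppf"

primrec arity :: "'u ppf \<Rightarrow> 'u" where
  "arity (Eqn \<epsilon> r) = \<epsilon>"
| "arity (ExConj \<epsilon> \<epsilon>' I \<psi>) = \<epsilon>"

text \<open>\<open>pp_stage \<kappa> \<mu> \<alpha> \<epsilon> \<phi>\<close> says \<open>\<phi> \<in> \<Lambda>\<^sup>\<kappa>\<^sup>,\<^sup>\<mu>\<close> with lower indices \<open>\<alpha>, \<epsilon>\<close>.\<close>

inductive pp_stage :: "'u::wellorder \<Rightarrow> 'u \<Rightarrow> 'u \<Rightarrow> 'u \<Rightarrow> 'u ppf \<Rightarrow> bool"
  for \<kappa> \<mu> :: "'u::wellorder" where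
  zero: "\<lbrakk>zero_ord \<alpha>; \<epsilon> < \<mu>; finite {\<xi>. r \<xi> \<noteq> 0}; {\<xi>. r \<xi> \<noteq> 0} \<subseteq> {..<\<epsilon>}\<rbrakk>
         \<Longrightarrow> pp_stage \<kappa> \<mu> \<alpha> \<epsilon> (Eqn \<epsilon> r)"
| succ: "\<lbrakk>succ_ord \<beta> \<alpha>; \<epsilon> \<le> \<epsilon>'; \<epsilon>' < \<mu>; |I| <o |{..<\<kappa>}|; \<forall>i\<in>I. pp_stage \<kappa> \<mu> \<beta> \<epsilon>' (\<psi> i)\<rbrakk>
         \<Longrightarrow> pp_stage \<kappa> \<mu> \<alpha> \<epsilon> (ExConj \<epsilon> \<epsilon>' I \<psi>)"
| limit: "\<lbrakk>limit_ord \<alpha>; \<beta> < \<alpha>; pp_stage \<kappa> \<mu> \<beta> \<epsilon> \<phi>\<rbrakk> \<Longrightarrow> pp_stage \<kappa> \<mu> \<alpha> \<epsilon> \<phi>"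

definition Lambda_infty :: "'u::wellorder ppf set" where
  "Lambda_infty = {\<phi>. \<exists>\<kappa> \<mu> \<alpha> \<epsilon>. infinite_card \<kappa> \<and> infinite_card \<mu> \<and> \<mu> \<le> \<kappa> \<and> \<epsilon> < \<mu> \<and>
     pp_stage \<kappa> \<mu> \<alpha> \<epsilon> \<phi>}"

primrec sat :: "'u::wellorder monoid \<Rightarrow> 'u ppf \<Rightarrow> ('u \<Rightarrow> 'u) \<Rightarrow> bool" where
  "sat A (Eqn \<epsilon> r) = (\<lambda>a. (\<Otimes>\<^bsub>A\<^esub>\<xi>\<in>{\<xi>. r \<xi> \<noteq> 0}. a \<xi> [^]\<^bsub>A\<^esub> r \<xi>) = \<one>\<^bsub>A\<^esub>)"
| "sat A (ExConj \<epsilon> \<epsilon>' I \<psi>) = (\<lambda>a. \<exists>b. (\<forall>\<xi><\<epsilon>. b \<xi> = a \<xi>) \<and>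
     (\<forall>\<xi>. \<epsilon> \<le> \<xi> \<longrightarrow> \<xi> < \<epsilon>' \<longrightarrow> b \<xi> \<in> carrier A) \<and> (\<forall>i\<in>I. sat A (\<psi> i) b))"

definition le_Sigma :: "'u::wellorder ppf set \<Rightarrow> ('u monoid \<times> 'u monoid) set" where
  "le_Sigma \<Sigma> = {(A, B). A \<in> ZMod \<and> B \<in> ZMod \<and> sub_structure A B \<and>
     (\<forall>\<phi>\<in>\<Sigma>. \<forall>a. (\<forall>\<xi><arity \<phi>. a \<xi> \<in> carrier A) \<longrightarrow> (sat A \<phi> a \<longleftrightarrow> sat B \<phi> a))}"

definition positive_syntactic :: "('u::wellorder monoid \<times> 'u monoid) set \<Rightarrow> bool" where
  "positive_syntactic R \<longleftrightarrow> (\<exists>\<Sigma>. \<Sigma> \<subseteq> Lambda_infty \<and> R = le_Sigma \<Sigma>)"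

end

theory Submission
  imports Defs
begin

text \<open>
  Say that \<open>A\<close> is strong in \<open>B\<close> if \<open>A \<le> B\<close> and every element of \<open>A\<close> that is divisible by 2 or
  by 3 in \<open>B\<close> is divisible by 2 or by 3 in \<open>A\<close>.  In other words, the subgroup is required to
  reflect the disjunction \<open>2|x \<or> 3|x\<close> of two pp-formulas.

  This relation is an AEC for general reasons.  Reflecting a formula is a reflexive, transitive
  and isomorphism invariant condition on \<open>A \<le> B\<close>.  The formula is positive existential, so it goes
  up from a subgroup to the group, which gives coherence; and a witness in the union of
  a chain already lies in a member of the chain, so unions behave well.  Closing a set under the
  group operations and under choice functions for the roots gives the Loewenheim-Skolem property.
  Pure subgroups reflect each divisibility separately, hence also the disjunction.  All this works for a disjunction \<open>\<exists>n\<in>N. n|x\<close> over any set \<open>N\<close> of numbers and is proved in this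
  generality (\<open>div_rel_LZ1\<close>).

  The relation is not positive syntactic because infinitary pp-formulas are compatible with direct
  sums and disjunctions are not.  Formulas in \<open>\<Lambda>\<close> are preserved by homomorphisms (\<open>sat_hom\<close>) and
  their solution sets are closed under addition (\<open>sat_mult\<close>); so they split along a direct
  decomposition, and if \<open>A\<^sub>1 \<le> B\<^sub>1\<close> and \<open>A\<^sub>2 \<le> B\<^sub>2\<close> are both in \<open>\<le>\<^sub>\<Sigma>\<close> then so is
  \<open>A\<^sub>1 \<oplus> A\<^sub>2 \<le> B\<^sub>1 \<oplus> B\<^sub>2\<close> (\<open>le_Sigma_decomposition\<close>).  Now take \<open>B\<^sub>1 \<oplus> B\<^sub>2 = \<int>/36\<close>
  with \<open>B\<^sub>1 = \<langle>4\<rangle>\<close> of order 9 and \<open>B\<^sub>2 = \<langle>9\<rangle>\<close> of order 4.  The subgroup \<open>A\<^sub>1 = \<langle>12\<rangle>\<close> of order 3 is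
  2-divisible and \<open>A\<^sub>2 = \<langle>18\<rangle>\<close> of order 2 is 3-divisible, so both are strong for
  trivial reasons.  But in their sum \<open>\<langle>6\<rangle>\<close> the generator 6 is divisible neither by 2 nor by 3, while
  \<open>6 = 2 \<cdot> 3\<close> is divisible by 2 in \<open>\<int>/36\<close>.
\<close>

section \<open>Substructures\<close>

lemma ZModD:
  assumes "A \<in> ZMod"
  shows "comm_group A" "group A" "small (carrier A)"
    "\<not> (x \<in> carrier A \<and> y \<in> carrier A) \<Longrightarrow> x \<otimes>\<^bsub>A\<^esub> y = undefined"
  using assms unfolding ZMod_def by (auto simp: comm_group_def)

text \<open>
  Between groups, being closed under inverses comes for free: the inclusion is a homomorphism, and
  the image of a homomorphism is a subgroup.
\<close>

lemma sub_structure_iff: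
  assumes "group A" "group B"
  shows "sub_structure A B \<longleftrightarrow> carrier A \<subseteq> carrier B \<and>
    (\<forall>x\<in>carrier A. \<forall>y\<in>carrier A. x \<otimes>\<^bsub>A\<^esub> y = x \<otimes>\<^bsub>B\<^esub> y)" (is "_ \<longleftrightarrow> ?R")
proof
  show "sub_structure A B \<Longrightarrow> ?R"
    unfolding sub_structure_def by (auto dest: subgroup.subset)
next
  assume R: ?R
  then have "(\<lambda>x. x) \<in> hom A B"
    by (auto simp: hom_def)
  then have "group_hom A B (\<lambda>x. x)"
    using assms by (simp add: group_hom_def group_hom_axioms_def)
  from group_hom.img_is_subgroup[OF this] R show "sub_structure A B"
    by (simp add: sub_structure_def)
qed

lemma sub_structure_hom:
  assumes "group A" "group B" "sub_structure A B"
  shows "(\<lambda>x. x) \<in> hom A B"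
  using assms by (auto simp: sub_structure_iff hom_def)

lemma sub_structure_one:
  assumes "group A" "group B" "sub_structure A B"
  shows "\<one>\<^bsub>A\<^esub> = \<one>\<^bsub>B\<^esub>"
  using hom_one[OF sub_structure_hom[OF assms]] assms by blast

lemma sub_structure_pow:
  assumes "group A" "group B" "sub_structure A B" "x \<in> carrier A"
  shows "x [^]\<^bsub>A\<^esub> (n::nat) = x [^]\<^bsub>B\<^esub> n"
  using hom_nat_pow[OF sub_structure_hom[OF assms(1-3)]] assms by blast

text \<open>
  This is where it matters that the multiplication of a member of \<open>ZMod\<close> is \<open>undefined\<close> off the
  carrier: mutual substructures then agree as records.
\<close>

lemma sub_structure_antisym:
  assumes "A \<in> ZMod" "B \<in> ZMod" "sub_structure A B" "sub_structure B A"
  shows "A = B"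
proof -
  note A = ZModD[OF assms(1)] and B = ZModD[OF assms(2)]
  have c: "carrier A = carrier B"
    using assms A B by (auto simp: sub_structure_iff)
  have "x \<otimes>\<^bsub>A\<^esub> y = x \<otimes>\<^bsub>B\<^esub> y" for x y
    using A(4)[of x y] B(4)[of x y] assms(3) c unfolding sub_structure_def
    by (cases "x \<in> carrier A \<and> y \<in> carrier A") auto
  moreover have "\<one>\<^bsub>A\<^esub> = \<one>\<^bsub>B\<^esub>"
    using sub_structure_one[OF A(2) B(2) assms(3)] .
  ultimately show ?thesis
    using c by (auto intro!: monoid.equality)
qed

definition induced :: "'u monoid \<Rightarrow> 'u set \<Rightarrow> 'u monoid" where
  "induced B Y = \<lparr>carrier = Y,
     mult = (\<lambda>x y. if x \<in> Y \<and> y \<in> Y then x \<otimes>\<^bsub>B\<^esub> y else undefined), one = \<one>\<^bsub>B\<^esub>\<rparr>"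

lemma induced_sub_structure:
  assumes "B \<in> ZMod" "subgroup Y B"
  shows "induced B Y \<in> ZMod" "sub_structure (induced B Y) B"
proof -
  interpret comm_group B using ZModD[OF assms(1)] by blast
  interpret Y: subgroup Y B by fact
  have "comm_group (induced B Y)"
  proof (rule comm_groupI)
    fix x assume "x \<in> carrier (induced B Y)"
    then have "inv\<^bsub>B\<^esub> x \<in> carrier (induced B Y)"
      "inv\<^bsub>B\<^esub> x \<otimes>\<^bsub>induced B Y\<^esub> x = \<one>\<^bsub>induced B Y\<^esub>"
      by (auto simp: induced_def Y.mem_carrier)
    then show "\<exists>y\<in>carrier (induced B Y). y \<otimes>\<^bsub>induced B Y\<^esub> x = \<one>\<^bsub>induced B Y\<^esub>"
      by blast
  qed (simp_all add: induced_def m_assoc Y.mem_carrier, simp add: m_comm Y.mem_carrier)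
  moreover have "small Y"
    using ZModD(3)[OF assms(1)] card_of_mono1[OF Y.subset] ordLeq_ordLess_trans
    unfolding small_def by blast
  ultimately show "induced B Y \<in> ZMod"
    by (auto simp: ZMod_def induced_def)
  show "sub_structure (induced B Y) B"
    using assms(2) by (auto simp: sub_structure_def induced_def)
qed


section \<open>Preserving a disjunction of divisibilities\<close>

text \<open>
  In multiplicative notation, divisibility by \<open>n\<close> is the existence of an \<open>n\<close>-th root.  For a singleton
  \<open>N\<close> this is a pp-formula; with more elements it is a disjunction of pp-formulas.
\<close>

definition some_div :: "nat set \<Rightarrow> 'u monoid \<Rightarrow> 'u \<Rightarrow> bool" where
  "some_div N A a \<longleftrightarrow> (\<exists>n\<in>N. \<exists>y\<in>carrier A. y [^]\<^bsub>A\<^esub> n = a)"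

definition div_rel :: "nat set \<Rightarrow> ('u::wellorder monoid \<times> 'u monoid) set" where
  "div_rel N = {(A, B). A \<in> ZMod \<and> B \<in> ZMod \<and> sub_structure A B \<and>
     (\<forall>a\<in>carrier A. some_div N B a \<longrightarrow> some_div N A a)}"

text \<open>
  Positive existential formulas are preserved upwards; hence only the downward direction appears in
  \<open>div_rel\<close>.
\<close>

lemma some_div_hom:
  assumes "h \<in> hom A B" "group A" "group B" "some_div N A a"
  shows "some_div N B (h a)"
  using assms hom_nat_pow[OF assms(1) _ assms(2,3)] unfolding some_div_def
  by (metis hom_in_carrier)

lemma some_div_mono:
  assumes "sub_structure A B" "group A" "group B" "some_div N A a"
  shows "some_div N B a"
  using some_div_hom[OF sub_structure_hom[OF assms(2,3,1)] assms(2-4)] .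

lemma div_rel_iso:
  assumes "(A, B) \<in> div_rel N" "A' \<in> ZMod" "B' \<in> ZMod" "f \<in> iso B B'" "f \<in> iso A A'"
  shows "(A', B') \<in> div_rel N"
proof -
  have AB: "A \<in> ZMod" "B \<in> ZMod" "sub_structure A B"
    and d: "\<And>a. a \<in> carrier A \<Longrightarrow> some_div N B a \<Longrightarrow> some_div N A a"
    using assms(1) by (auto simp: div_rel_def)
  note gr = ZModD(2)[OF AB(1)] ZModD(2)[OF AB(2)] ZModD(2)[OF assms(2)] ZModD(2)[OF assms(3)]
  have cA: "carrier A' = f ` carrier A" and cB: "carrier B' = f ` carrier B"
    using assms(4,5) by (auto simp: iso_def bij_betw_def)
  have hA: "f \<in> hom A A'" and hB: "f \<in> hom B B'" and inj: "inj_on f (carrier B)"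
    using assms(4,5) by (auto simp: iso_def bij_betw_def)
  have AsB: "carrier A \<subseteq> carrier B"
    and m: "\<And>x y. x \<in> carrier A \<Longrightarrow> y \<in> carrier A \<Longrightarrow> x \<otimes>\<^bsub>A\<^esub> y = x \<otimes>\<^bsub>B\<^esub> y"
    using AB(3) gr by (auto simp: sub_structure_iff)
  have "x \<otimes>\<^bsub>A'\<^esub> y = x \<otimes>\<^bsub>B'\<^esub> y" if xy: "x \<in> carrier A'" "y \<in> carrier A'" for x y
  proof -
    obtain u v where uv: "u \<in> carrier A" "v \<in> carrier A" "x = f u" "y = f v"
      using xy cA by auto
    then show ?thesis
      using hom_mult[OF hA, of u v] hom_mult[OF hB, of u v] m[of u v] AsB by auto
  qed
  then have "sub_structure A' B'"
    using gr cA cB AsB by (auto simp: sub_structure_iff)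
  moreover have "some_div N A' a'" if a': "a' \<in> carrier A'" and D: "some_div N B' a'" for a'
  proof -
    obtain a where a: "a \<in> carrier A" "a' = f a"
      using a' cA by auto
    obtain n y where n: "n \<in> N" "y \<in> carrier B" "f y [^]\<^bsub>B'\<^esub> n = f a"
      using D a cB by (auto simp: some_div_def)
    then have "f (y [^]\<^bsub>B\<^esub> n) = f a"
      using hom_nat_pow[OF hB n(2) gr(2,4)] by simp
    then have "y [^]\<^bsub>B\<^esub> n = a"
      using inj a AsB n gr(2) by (meson inj_onD group.is_monoid monoid.nat_pow_closed subsetD)
    then have "some_div N B a"
      using n by (auto simp: some_div_def)
    then show ?thesis
      using d a some_div_hom[OF hA gr(1,3)] by auto
  qed
  ultimately show ?thesis
    using assms by (auto simp: div_rel_def)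
qed

lemma div_rel_partial_order: "partial_order_on ZMod (div_rel N)"
  unfolding partial_order_on_def preorder_on_def
proof (intro conjI)
  show "div_rel N \<subseteq> ZMod \<times> ZMod"
    by (auto simp: div_rel_def)
  show "refl_on ZMod (div_rel N)"
    by (auto simp: refl_on_def div_rel_def sub_structure_iff ZModD(2))
  show "antisym (div_rel N)"
    by (auto simp: antisym_def div_rel_def intro: sub_structure_antisym)
  show "trans (div_rel N)"
    by (auto simp: trans_def div_rel_def sub_structure_iff ZModD(2) subset_iff)
qed

lemma div_rel_coherent:
  assumes "(A, C) \<in> div_rel N" "(B, C) \<in> div_rel N" "sub_structure A B"
  shows "(A, B) \<in> div_rel N"
proof -
  have Z: "A \<in> ZMod" "B \<in> ZMod" "C \<in> ZMod" and BC: "sub_structure B C"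
    using assms by (auto simp: div_rel_def)
  have "some_div N C a" if "some_div N B a" for a
    using some_div_mono[OF BC ZModD(2)[OF Z(2)] ZModD(2)[OF Z(3)] that] .
  then show ?thesis
    using assms by (auto simp: div_rel_def)
qed


section \<open>Unions of chains\<close>

lemma infinite_universe:
  assumes "set_universe TYPE('u::wellorder)"
  shows "infinite (UNIV :: 'u set)"
  using assms ordLess_imp_ordLeq infinite_iff_natLeq_ordLeq unfolding set_universe_def by blast

text \<open>Regularity of \<open>\<Omega>\<close> makes \<open>|UNIV|\<close> stable: it is not reached by fewer than \<open>\<Omega>\<close> small sets.\<close>

lemma small_UNION:
  fixes A :: "'i \<Rightarrow> 'u::wellorder set"
  assumes "set_universe TYPE('u)" "|I| <o |UNIV :: 'u set|" "\<And>i. i \<in> I \<Longrightarrow> small (A i)"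
  shows "small (\<Union>i\<in>I. A i)"
proof -
  have "stable |UNIV :: 'u set|"
    using assms(1) infinite_universe[OF assms(1)]
    by (intro regularCard_stable) (auto simp: set_universe_def card_of_card_order_on Field_card_of)
  then show ?thesis
    unfolding small_def by (rule stable_UNION) (use assms in \<open>auto simp: small_def\<close>)
qed

locale ZMod_chain =
  fixes \<delta> :: "'u::wellorder" and A :: "'u \<Rightarrow> 'u monoid"
  assumes universe: "set_universe TYPE('u)"
    and limit: "limit_ord \<delta>"
    and ZMod: "i < \<delta> \<Longrightarrow> A i \<in> ZMod"
    and sub: "i \<le> j \<Longrightarrow> j < \<delta> \<Longrightarrow> sub_structure (A i) (A j)"
begin

abbreviation "U \<equiv> chain_Union A \<delta>"

lemma carrier_Union: "carrier U = (\<Union>i\<in>{..<\<delta>}. carrier (A i))"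
  by (simp add: chain_Union_def)

lemma carrier_mono: "i \<le> j \<Longrightarrow> j < \<delta> \<Longrightarrow> carrier (A i) \<subseteq> carrier (A j)"
  using sub[of i j] unfolding sub_structure_def by (auto dest: subgroup.subset)

text \<open>
  The union multiplies in the first group that contains both factors; by the substructure
  condition any later group gives the same product.
\<close>

lemma mult_Union:
  assumes "i < \<delta>" "x \<in> carrier (A i)" "y \<in> carrier (A i)"
  shows "x \<otimes>\<^bsub>U\<^esub> y = x \<otimes>\<^bsub>A i\<^esub> y"
proof -
  define k where "k = (LEAST i. x \<in> carrier (A i) \<and> y \<in> carrier (A i))"
  have k: "x \<in> carrier (A k)" "y \<in> carrier (A k)" "k \<le> i"
    using assms LeastI[of "\<lambda>i. x \<in> carrier (A i) \<and> y \<in> carrier (A i)" i]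
      Least_le[of "\<lambda>i. x \<in> carrier (A i) \<and> y \<in> carrier (A i)" i] by (auto simp: k_def)
  then have "x \<otimes>\<^bsub>A k\<^esub> y = x \<otimes>\<^bsub>A i\<^esub> y"
    using sub[of k i] assms unfolding sub_structure_def by auto
  then show ?thesis
    using assms by (auto simp: chain_Union_def k_def)
qed

lemma one_Union:
  assumes "i < \<delta>"
  shows "\<one>\<^bsub>U\<^esub> = \<one>\<^bsub>A i\<^esub>"
proof -
  define k :: 'u where "k = (LEAST i. True)"
  have "k \<le> i"
    by (simp add: k_def Least_le)
  then show ?thesis
    using sub_structure_one[of "A k" "A i"] sub[of k i] ZModD(2)[OF ZMod] assms
    by (auto simp: chain_Union_def k_def)
qed

lemma common_index:
  assumes "x \<in> carrier U" "y \<in> carrier U"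
  obtains i where "i < \<delta>" "x \<in> carrier (A i)" "y \<in> carrier (A i)"
proof -
  obtain i j where "i < \<delta>" "j < \<delta>" "x \<in> carrier (A i)" "y \<in> carrier (A j)"
    using assms by (auto simp: carrier_Union)
  then show ?thesis
    using that[of "max i j"] carrier_mono[of i "max i j"] carrier_mono[of j "max i j"]
    by auto
qed

lemma Union_comm_group: "comm_group U"
proof (rule comm_groupI)
  obtain i0 where i0: "i0 < \<delta>"
    using limit by (auto simp: limit_ord_def)
  interpret I0: comm_group "A i0" using ZModD(1)[OF ZMod[OF i0]] .
  show "\<one>\<^bsub>U\<^esub> \<in> carrier U"
    using i0 by (auto simp: one_Union carrier_Union)
next
  fix x y assume "x \<in> carrier U" "y \<in> carrier U"
  then obtain i where i: "i < \<delta>" "x \<in> carrier (A i)" "y \<in> carrier (A i)"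
    by (rule common_index)
  interpret I: comm_group "A i" using ZModD(1)[OF ZMod[OF i(1)]] .
  show "x \<otimes>\<^bsub>U\<^esub> y \<in> carrier U"
    using i by (auto simp: mult_Union carrier_Union)
  show "x \<otimes>\<^bsub>U\<^esub> y = y \<otimes>\<^bsub>U\<^esub> x"
    using i by (simp add: mult_Union I.m_comm)
next
  fix x y z assume xyz: "x \<in> carrier U" "y \<in> carrier U" "z \<in> carrier U"
  from xyz(1,2) obtain i where i: "i < \<delta>" "x \<in> carrier (A i)" "y \<in> carrier (A i)"
    by (rule common_index)
  obtain j where j: "j < \<delta>" "z \<in> carrier (A j)"
    using xyz by (auto simp: carrier_Union)
  define k where "k = max i j"
  have k: "k < \<delta>" "x \<in> carrier (A k)" "y \<in> carrier (A k)" "z \<in> carrier (A k)"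
    using i j carrier_mono[of i k] carrier_mono[of j k] by (auto simp: k_def)
  interpret I: comm_group "A k" using ZModD(1)[OF ZMod[OF k(1)]] .
  show "x \<otimes>\<^bsub>U\<^esub> y \<otimes>\<^bsub>U\<^esub> z = x \<otimes>\<^bsub>U\<^esub> (y \<otimes>\<^bsub>U\<^esub> z)"
    using k by (simp add: mult_Union[OF k(1)] I.m_assoc)
next
  fix x assume "x \<in> carrier U"
  then obtain i where i: "i < \<delta>" "x \<in> carrier (A i)"
    by (auto simp: carrier_Union)
  interpret I: comm_group "A i" using ZModD(1)[OF ZMod[OF i(1)]] .
  show "\<one>\<^bsub>U\<^esub> \<otimes>\<^bsub>U\<^esub> x = x"
    using i by (simp add: one_Union[OF i(1)] mult_Union[OF i(1)])
  have "inv\<^bsub>A i\<^esub> x \<otimes>\<^bsub>U\<^esub> x = \<one>\<^bsub>U\<^esub>" "inv\<^bsub>A i\<^esub> x \<in> carrier U"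
    using i by (auto simp: one_Union[OF i(1)] mult_Union[OF i(1)] carrier_Union)
  then show "\<exists>y\<in>carrier U. y \<otimes>\<^bsub>U\<^esub> x = \<one>\<^bsub>U\<^esub>" by blast
qed

lemma Union_ZMod: "U \<in> ZMod"
proof -
  have "small (carrier U)"
    unfolding carrier_Union using universe ZModD(3)[OF ZMod]
    by (intro small_UNION) (auto simp: set_universe_def)
  moreover have "x \<otimes>\<^bsub>U\<^esub> y = undefined" if "\<not> (x \<in> carrier U \<and> y \<in> carrier U)" for x y
    using that by (auto simp: chain_Union_def)
  ultimately show ?thesis
    using Union_comm_group by (auto simp: ZMod_def)
qed

lemma sub_Union: "i < \<delta> \<Longrightarrow> sub_structure (A i) U"
  using ZModD(2)[OF Union_ZMod] ZModD(2)[OF ZMod]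
  by (auto simp: sub_structure_iff mult_Union carrier_Union)

lemma Union_sub:
  assumes "B \<in> ZMod" "\<And>i. i < \<delta> \<Longrightarrow> sub_structure (A i) B"
  shows "sub_structure U B"
proof -
  have "x \<otimes>\<^bsub>U\<^esub> y = x \<otimes>\<^bsub>B\<^esub> y" if xy: "x \<in> carrier U" "y \<in> carrier U" for x y
  proof -
    obtain i where "i < \<delta>" "x \<in> carrier (A i)" "y \<in> carrier (A i)"
      using common_index[OF xy] .
    then show ?thesis
      using assms(2) by (simp add: sub_structure_def mult_Union)
  qed
  moreover have "carrier U \<subseteq> carrier B"
    using assms(2) by (auto simp: carrier_Union sub_structure_def dest: subgroup.subset)
  ultimately show ?thesis
    using ZModD(2)[OF Union_ZMod] ZModD(2)[OF assms(1)] by (auto simp: sub_structure_iff)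
qed

text \<open>
  A root in the union already lies in some member of the chain.  It may lie above the member that
  contains \<open>a\<close>; the chain condition brings it down.
\<close>

lemma some_div_Union:
  assumes "some_div N U a"
  obtains i where "i < \<delta>" "some_div N (A i) a"
proof -
  obtain n y where n: "n \<in> N" "y \<in> carrier U" "y [^]\<^bsub>U\<^esub> n = a"
    using assms by (auto simp: some_div_def)
  then obtain i where i: "i < \<delta>" "y \<in> carrier (A i)"
    by (auto simp: carrier_Union)
  then have "y [^]\<^bsub>A i\<^esub> n = a"
    using sub_structure_pow[OF ZModD(2)[OF ZMod] ZModD(2)[OF Union_ZMod] sub_Union, of i y n] n
    by simp
  then show ?thesis
    using that i n by (auto simp: some_div_def)
qed

end

lemma div_rel_chain:
  fixes \<delta> :: "'u::wellorder"
  assumes "set_universe TYPE('u)" "limit_ord \<delta>" "\<forall>i<\<delta>. A i \<in> ZMod"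
    "continuous_chain (div_rel N) \<delta> A"
  shows "chain_Union A \<delta> \<in> ZMod"
    and "j < \<delta> \<Longrightarrow> (A j, chain_Union A \<delta>) \<in> div_rel N"
    and "B \<in> ZMod \<Longrightarrow> \<forall>i<\<delta>. (A i, B) \<in> div_rel N \<Longrightarrow> (chain_Union A \<delta>, B) \<in> div_rel N"
proof -
  have R: "(A i, A j) \<in> div_rel N" if "i \<le> j" "j < \<delta>" for i j
    using assms(4) that by (auto simp: continuous_chain_def)
  interpret ZMod_chain \<delta> A
    by unfold_locales (use assms R in \<open>auto simp: div_rel_def\<close>)
  show "chain_Union A \<delta> \<in> ZMod"
    by (rule Union_ZMod)
  show "(A j, U) \<in> div_rel N" if j: "j < \<delta>"
  proof -
    have "some_div N (A j) a" if a: "a \<in> carrier (A j)" "some_div N U a" for a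
    proof -
      obtain i where i: "i < \<delta>" "some_div N (A i) a"
        using some_div_Union[OF a(2)] .
      let ?k = "max i j"
      have k: "?k < \<delta>" using i j by simp
      have "some_div N (A ?k) a"
        using some_div_mono[OF sub[OF _ k] _ _ i(2)] ZModD(2)[OF ZMod] i k by simp
      then show ?thesis
        using R[of j ?k] k a by (auto simp: div_rel_def)
    qed
    then show ?thesis
      using j ZMod Union_ZMod sub_Union by (auto simp: div_rel_def)
  qed
  show "(U, B) \<in> div_rel N" if B: "B \<in> ZMod" "\<forall>i<\<delta>. (A i, B) \<in> div_rel N"
  proof -
    have "some_div N U a" if a: "a \<in> carrier U" "some_div N B a" for a
    proof -
      obtain i where i: "i < \<delta>" "a \<in> carrier (A i)"
        using a by (auto simp: carrier_Union)
      then have "some_div N (A i) a"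
        using B a by (auto simp: div_rel_def)
      then show ?thesis
        using some_div_mono[OF sub_Union ZModD(2)[OF ZMod] ZModD(2)[OF Union_ZMod]] i by blast
    qed
    then show ?thesis
      using B Union_ZMod Union_sub by (auto simp: div_rel_def)
  qed
qed


section \<open>The Loewenheim-Skolem property\<close>

lemma Un_ordLeq_infinite:
  assumes "infinite T" "|A| \<le>o |T|" "|B| \<le>o |T|"
  shows "|A \<union> B| \<le>o |T|"
  using card_of_Un_ordLeq_infinite_Field[of "|T|"] assms by (simp add: card_of_card_order_on Field_card_of)

text \<open>
  The closure is reached after \<open>\<omega>\<close> rounds; each round adds countably many images of a square, which
  does not exceed the cardinality of an infinite \<open>T\<close>.
\<close>

lemma closure_under_countable_family:
  fixes F :: "nat \<Rightarrow> 'u \<Rightarrow> 'u \<Rightarrow> 'u" and T :: "'t set"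
  assumes T: "infinite T" and X: "|X| \<le>o |T|" "X \<subseteq> C"
    and C: "\<And>k x y. x \<in> C \<Longrightarrow> y \<in> C \<Longrightarrow> F k x y \<in> C"
  obtains Y where "X \<subseteq> Y" "Y \<subseteq> C" "|Y| \<le>o |T|"
    "\<And>k x y. x \<in> Y \<Longrightarrow> y \<in> Y \<Longrightarrow> F k x y \<in> Y"
proof -
  define Z where "Z = rec_nat X (\<lambda>_ Y. Y \<union> (\<Union>k. (\<lambda>(x, y). F k x y) ` (Y \<times> Y)))"
  have Z0: "Z 0 = X"
    and ZS: "\<And>n. Z (Suc n) = Z n \<union> (\<Union>k. (\<lambda>(x, y). F k x y) ` (Z n \<times> Z n))"
    by (simp_all add: Z_def)
  have nat: "|UNIV :: nat set| \<le>o |T|"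
    using T infinite_iff_card_of_nat by blast
  have "|Z n| \<le>o |T| \<and> Z n \<subseteq> C" for n
  proof (induction n)
    case 0
    then show ?case using X Z0 by simp
  next
    case (Suc n)
    have "|(\<lambda>(x, y). F k x y) ` (Z n \<times> Z n)| \<le>o |T|" for k
    proof -
      have "|Z n \<times> Z n| \<le>o |T|"
        using card_of_Times_ordLeq_infinite_Field[of "|T|" "Z n" "Z n"] T Suc
        by (simp add: card_of_card_order_on Field_card_of)
      then show ?thesis
        using card_of_image ordLeq_transitive by blast
    qed
    then have "|\<Union>k. (\<lambda>(x, y). F k x y) ` (Z n \<times> Z n)| \<le>o |T|"
      by (intro card_of_UNION_ordLeq_infinite[OF T nat]) blast
    then have "|Z (Suc n)| \<le>o |T|"
      unfolding ZS using Un_ordLeq_infinite[OF T] Suc by blast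
    moreover have "Z (Suc n) \<subseteq> C"
      using Suc C by (auto simp: ZS)
    ultimately show ?case by blast
  qed
  note bound = this
  have mono: "m \<le> n \<Longrightarrow> Z m \<subseteq> Z n" for m n
    by (rule lift_Suc_mono_le[of Z]) (auto simp: ZS)
  show ?thesis
  proof (rule that[of "\<Union>n. Z n"])
    show "X \<subseteq> (\<Union>n. Z n)" using Z0 by blast
    show "(\<Union>n. Z n) \<subseteq> C" using bound by blast
    show "|\<Union>n. Z n| \<le>o |T|"
      using card_of_UNION_ordLeq_infinite[OF T nat] bound by blast
    fix k x y assume "x \<in> (\<Union>n. Z n)" "y \<in> (\<Union>n. Z n)"
    then obtain m n where "x \<in> Z m" "y \<in> Z n" by blast
    then have "x \<in> Z (max m n)" "y \<in> Z (max m n)"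
      using mono[of m "max m n"] mono[of n "max m n"] by auto
    then have "F k x y \<in> Z (Suc (max m n))"
      by (force simp: ZS)
    then show "F k x y \<in> (\<Union>n. Z n)" by blast
  qed
qed

text \<open>
  A subgroup that is closed under a choice of \<open>n\<close>-th roots in \<open>B\<close>, for every \<open>n\<close>, reflects all
  divisibilities.
\<close>

lemma div_rel_Loewenheim_Skolem:
  fixes B :: "'u::wellorder monoid" and T :: "'t set"
  assumes B: "B \<in> ZMod" and X: "X \<subseteq> carrier B" "|X| \<le>o |T|" and T: "infinite T"
  shows "\<exists>A\<in>ZMod. X \<subseteq> carrier A \<and> (A, B) \<in> div_rel N \<and> |carrier A| \<le>o |T|"
proof -
  interpret comm_group B using ZModD(1)[OF B] .
  \<comment> \<open>Index 0 is for the subgroup operations, index \<open>Suc n\<close> for \<open>n\<close>-th roots; the value \<open>\<one>\<close> only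
      serves to stay inside \<open>B\<close> where there is no root.\<close>
  define F where "F k x y = (case k of 0 \<Rightarrow> x \<otimes>\<^bsub>B\<^esub> inv\<^bsub>B\<^esub> y
    | Suc n \<Rightarrow> if \<exists>z\<in>carrier B. z [^]\<^bsub>B\<^esub> n = x then SOME z. z \<in> carrier B \<and> z [^]\<^bsub>B\<^esub> n = x
              else \<one>\<^bsub>B\<^esub>)" for k x y
  have root: "F (Suc n) x y \<in> carrier B \<and> F (Suc n) x y [^]\<^bsub>B\<^esub> n = x"
    if "\<exists>z\<in>carrier B. z [^]\<^bsub>B\<^esub> n = x" for n x y
    using that someI_ex[of "\<lambda>z. z \<in> carrier B \<and> z [^]\<^bsub>B\<^esub> n = x"] by (auto simp: F_def)
  have closed: "F k x y \<in> carrier B" if "x \<in> carrier B" "y \<in> carrier B" for k x y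
  proof (cases k)
    case 0
    then show ?thesis using that by (simp add: F_def)
  next
    case (Suc n)
    then show ?thesis
      using root[of n x y] by (cases "\<exists>z\<in>carrier B. z [^]\<^bsub>B\<^esub> n = x") (auto simp: F_def)
  qed
  have "|insert \<one>\<^bsub>B\<^esub> X| \<le>o |T|"
    using Un_ordLeq_infinite[OF T, of "{\<one>\<^bsub>B\<^esub>}" X] T X(2)
    using card_of_singl_ordLeq[of T "\<one>\<^bsub>B\<^esub>"] by fastforce
  moreover have "insert \<one>\<^bsub>B\<^esub> X \<subseteq> carrier B"
    using X(1) by simp
  ultimately obtain Y where Y: "insert \<one>\<^bsub>B\<^esub> X \<subseteq> Y" "Y \<subseteq> carrier B" "|Y| \<le>o |T|"
    "\<And>k x y. x \<in> Y \<Longrightarrow> y \<in> Y \<Longrightarrow> F k x y \<in> Y"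
    by (rule closure_under_countable_family[OF T, of _ _ F]) (use closed in blast)+
  have inv: "inv\<^bsub>B\<^esub> y \<in> Y" if "y \<in> Y" for y
    using Y(4)[of "\<one>\<^bsub>B\<^esub>" y 0] Y(1,2) that by (auto simp: F_def)
  have "subgroup Y B"
  proof (rule subgroupI)
    fix x y assume "x \<in> Y" "y \<in> Y"
    then show "x \<otimes>\<^bsub>B\<^esub> y \<in> Y"
      using Y(4)[of x "inv\<^bsub>B\<^esub> y" 0] inv Y(2) by (auto simp: F_def)
  qed (use Y inv in auto)
  note A = induced_sub_structure[OF B this]
  have "some_div N (induced B Y) a" if a: "a \<in> Y" "some_div N B a" for a
  proof -
    obtain n where n: "n \<in> N" "\<exists>z\<in>carrier B. z [^]\<^bsub>B\<^esub> n = a"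
      using a by (auto simp: some_div_def)
    let ?z = "F (Suc n) a a"
    have "?z \<in> Y" "?z [^]\<^bsub>B\<^esub> n = a"
      using root[OF n(2)] Y(4) a by auto
    then show ?thesis
      using sub_structure_pow[OF ZModD(2)[OF A(1)] ZModD(2)[OF B] A(2), of ?z n] n(1)
      by (auto simp: some_div_def induced_def)
  qed
  then have "(induced B Y, B) \<in> div_rel N"
    using A B by (auto simp: div_rel_def induced_def)
  then show ?thesis
    using A Y by (intro bexI[of _ "induced B Y"]) (auto simp: induced_def)
qed

lemma div_rel_AEC:
  assumes "set_universe TYPE('u::wellorder)"
  shows "AEC ZMod (div_rel N :: ('u monoid \<times> 'u monoid) set)"
proof -
  have inf: "natLeq <o |UNIV :: 'u set|"
    using assms by (simp add: set_universe_def)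
  obtain f :: "nat \<Rightarrow> 'u" where f: "inj f"
    using infinite_countable_subset[OF infinite_universe[OF assms]] by blast
  define S where "S = range f"
  have S: "|S| =o natLeq"
    using card_of_ordIsoI[of f UNIV S] f card_of_nat ordIso_symmetric ordIso_transitive
    unfolding S_def bij_betw_def by blast
  then have S_small: "small S" and S_le: "natLeq \<le>o |S|"
    using inf ordIso_ordLess_trans ordIso_symmetric ordIso_imp_ordLeq
    unfolding small_def by blast+
  have S_inf: "infinite S"
    using f by (simp add: S_def finite_image_iff)
  have LS: "\<exists>A\<in>ZMod. X \<subseteq> carrier A \<and> (A, B) \<in> div_rel N \<and> |carrier A| \<le>o |X| +c |S|"
    if "B \<in> ZMod" "X \<subseteq> carrier B" for B :: "'u monoid" and X
  proof -
    have "|X| +c |S| = |X <+> S|"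
      by (simp add: csum_def Field_card_of)
    then show ?thesis
      using div_rel_Loewenheim_Skolem[OF that card_of_Plus1, of S N] S_inf by auto
  qed
  show ?thesis
    unfolding AEC_def
  proof (intro conjI)
    show "\<forall>(A, B)\<in>div_rel N. sub_structure A B"
      by (auto simp: div_rel_def)
    show "\<exists>S::'u set. small S \<and> natLeq \<le>o |S| \<and>
        (\<forall>B\<in>ZMod. \<forall>X. X \<subseteq> carrier B \<longrightarrow>
           (\<exists>A\<in>ZMod. X \<subseteq> carrier A \<and> (A, B) \<in> (div_rel N :: ('u monoid \<times> 'u monoid) set) \<and>
              |carrier A| \<le>o |X| +c |S| ))"
      by (intro exI[of _ S] conjI ballI allI impI S_small S_le LS)
    show "\<forall>A\<in>ZMod. \<forall>B\<in>ZMod. \<forall>A'\<in>ZMod. \<forall>B'\<in>ZMod. \<forall>f. (A, B) \<in> div_rel N \<longrightarrow>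
        f \<in> iso B B' \<longrightarrow> f \<in> iso A A' \<longrightarrow> (A', B') \<in> (div_rel N :: ('u monoid \<times> 'u monoid) set)"
      by (intro ballI allI impI) (rule div_rel_iso)
    show "\<forall>\<delta> A. limit_ord \<delta> \<longrightarrow> (\<forall>i<\<delta>. A i \<in> ZMod) \<longrightarrow> continuous_chain (div_rel N) \<delta> A \<longrightarrow>
        chain_Union A \<delta> \<in> ZMod \<and>
        (\<forall>j<\<delta>. (A j, chain_Union A \<delta>) \<in> div_rel N) \<and>
        (\<forall>B\<in>ZMod. (\<forall>i<\<delta>. (A i, B) \<in> div_rel N) \<longrightarrow>
          (chain_Union A \<delta>, B) \<in> (div_rel N :: ('u monoid \<times> 'u monoid) set))"
      by (intro allI impI conjI ballI; rule div_rel_chain[OF assms]; assumption)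
    show "partial_order_on ZMod (div_rel N :: ('u monoid \<times> 'u monoid) set)"
      by (rule div_rel_partial_order)
    show "\<forall>A\<in>ZMod. \<forall>B\<in>ZMod. \<forall>C\<in>ZMod. (A, C) \<in> div_rel N \<longrightarrow> (B, C) \<in> div_rel N \<longrightarrow>
        sub_structure A B \<longrightarrow> (A, B) \<in> (div_rel N :: ('u monoid \<times> 'u monoid) set)"
      by (intro ballI impI) (rule div_rel_coherent)
  qed auto
qed


section \<open>Summands and pure subgroups\<close>

text \<open>
  If \<open>B = A \<oplus> C\<close> and \<open>a = n(c + d)\<close> with \<open>a, c \<in> A\<close> and \<open>d \<in> C\<close>, then \<open>nd = a - nc\<close> lies in
  \<open>A \<inter> C = 0\<close>, so \<open>a = nc\<close>.
\<close>

lemma div_rel_direct_summand: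
  assumes AB: "A \<in> ZMod" "B \<in> ZMod" and ds: "direct_summand A B"
  shows "(A, B) \<in> div_rel N"
proof -
  obtain C where C: "C \<in> ZMod" "sub_structure C B" "carrier A \<inter> carrier C = {\<one>\<^bsub>B\<^esub>}"
    "carrier A <#>\<^bsub>B\<^esub> carrier C = carrier B" and sub: "sub_structure A B"
    using ds by (auto simp: direct_summand_def)
  interpret comm_group B using ZModD(1)[OF AB(2)] .
  interpret A: subgroup "carrier A" B using sub by (simp add: sub_structure_def)
  interpret C: subgroup "carrier C" B using C by (simp add: sub_structure_def)
  note pA = sub_structure_pow[OF ZModD(2)[OF AB(1)] ZModD(2)[OF AB(2)] sub]
  note pC = sub_structure_pow[OF ZModD(2)[OF C(1)] ZModD(2)[OF AB(2)] C(2)]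
  have "some_div N A a" if a: "a \<in> carrier A" "some_div N B a" for a
  proof -
    obtain n y where n: "n \<in> N" "y \<in> carrier B" "y [^]\<^bsub>B\<^esub> n = a"
      using a by (auto simp: some_div_def)
    then obtain c d where cd: "c \<in> carrier A" "d \<in> carrier C" "y = c \<otimes>\<^bsub>B\<^esub> d"
      unfolding C(4)[symmetric] set_mult_def by blast
    have cn: "c [^]\<^bsub>B\<^esub> n \<in> carrier A"
      using cd pA[of c n] group.is_monoid[OF ZModD(2)[OF AB(1)]]
      by (metis monoid.nat_pow_closed)
    have dn: "d [^]\<^bsub>B\<^esub> n \<in> carrier C"
      using cd pC[of d n] group.is_monoid[OF ZModD(2)[OF C(1)]]
      by (metis monoid.nat_pow_closed)
    have an: "a = c [^]\<^bsub>B\<^esub> n \<otimes>\<^bsub>B\<^esub> d [^]\<^bsub>B\<^esub> n"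
      using n cd by (simp add: nat_pow_distrib)
    have "d [^]\<^bsub>B\<^esub> n = inv\<^bsub>B\<^esub> (c [^]\<^bsub>B\<^esub> n) \<otimes>\<^bsub>B\<^esub> a"
      using an cn dn by (simp add: m_assoc[symmetric])
    then have "d [^]\<^bsub>B\<^esub> n \<in> carrier A"
      using cn a by simp
    then have "d [^]\<^bsub>B\<^esub> n = \<one>\<^bsub>B\<^esub>"
      using dn C(3) by blast
    then have "c [^]\<^bsub>A\<^esub> n = a"
      using an cn pA[OF cd(1)] by simp
    then show ?thesis
      using n cd by (auto simp: some_div_def)
  qed
  then show ?thesis
    using AB sub by (auto simp: div_rel_def)
qed

lemma solvable_in_single:
  assumes "comm_group A"
  shows "solvable_in A 1 1 (\<lambda>_ _. int n) (\<lambda>_. a) \<longleftrightarrow> (\<exists>y\<in>carrier A. y [^]\<^bsub>A\<^esub> n = a)"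
proof -
  interpret comm_group A by fact
  have "(\<Otimes>\<^bsub>A\<^esub>j\<in>{..<1::nat}. x j [^]\<^bsub>A\<^esub> int n) = x 0 [^]\<^bsub>A\<^esub> n" if "x 0 \<in> carrier A" for x
    using that by (simp add: lessThan_Suc int_pow_int)
  then show ?thesis
    unfolding solvable_in_def by (auto intro: exI[of _ "\<lambda>_. y" for y])
qed

lemma div_rel_pure:
  assumes AB: "A \<in> ZMod" "B \<in> ZMod" and pure: "pure_in A B"
  shows "(A, B) \<in> div_rel N"
proof -
  have "some_div N A a" if a: "a \<in> carrier A" "some_div N B a" for a
  proof -
    obtain n where n: "n \<in> N" "\<exists>y\<in>carrier B. y [^]\<^bsub>B\<^esub> n = a"
      using a by (auto simp: some_div_def)
    then have "solvable_in A 1 1 (\<lambda>_ _. int n) (\<lambda>_. a)"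
      using pure a(1) solvable_in_single[OF ZModD(1)[OF AB(2)]] by (auto simp: pure_in_def)
    then show ?thesis
      using n(1) solvable_in_single[OF ZModD(1)[OF AB(1)]] by (auto simp: some_div_def)
  qed
  then show ?thesis
    using AB pure by (auto simp: div_rel_def pure_in_def)
qed

lemma div_rel_LZ1:
  assumes "set_universe TYPE('u::wellorder)"
  shows "(div_rel N :: ('u monoid \<times> 'u monoid) set) \<in> LZ1"
  using div_rel_AEC[OF assms] div_rel_direct_summand div_rel_pure
  by (auto simp: LZ1_def LZ_def)


section \<open>Positive primitive formulas, homomorphisms and sums\<close>

lemma pp_stage_arity: "pp_stage \<kappa> \<mu> \<alpha> \<epsilon> \<phi> \<Longrightarrow> arity \<phi> = \<epsilon>"
  by (induction rule: pp_stage.induct) auto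

lemma finprod_hom:
  assumes "h \<in> hom A B" "comm_group A" "comm_group B" "finite I" "\<And>i. i \<in> I \<Longrightarrow> f i \<in> carrier A"
  shows "h (\<Otimes>\<^bsub>A\<^esub>i\<in>I. f i) = (\<Otimes>\<^bsub>B\<^esub>i\<in>I. h (f i))"
proof -
  interpret A: comm_group A by fact
  interpret B: comm_group B by fact
  show ?thesis
    using assms(4,5)
  proof (induction I rule: finite_induct)
    case empty
    then show ?case using hom_one[OF assms(1)] by simp
  next
    case (insert i I)
    then have "(\<Otimes>\<^bsub>A\<^esub>i\<in>I. f i) \<in> carrier A" "f \<in> I \<rightarrow> carrier A"
      "(\<lambda>i. h (f i)) \<in> I \<rightarrow> carrier B" "h (f i) \<in> carrier B"
      using hom_in_carrier[OF assms(1)] by (auto intro!: A.finprod_closed)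
    then show ?case
      using insert hom_mult[OF assms(1)] by simp
  qed
qed

text \<open>
  The assignments \<open>a\<close> and \<open>a'\<close> are related only below \<open>\<epsilon>\<close>, so that the induction can extend them
  by witnesses for the bound variables.
\<close>

lemma sat_hom:
  assumes "pp_stage \<kappa> \<mu> \<alpha> \<epsilon> \<phi>" "comm_group A" "comm_group B" "h \<in> hom A B"
    "\<And>\<xi>. \<xi> < \<epsilon> \<Longrightarrow> a \<xi> \<in> carrier A" "\<And>\<xi>. \<xi> < \<epsilon> \<Longrightarrow> a' \<xi> = h (a \<xi>)" "sat A \<phi> a"
  shows "sat B \<phi> a'"
  using assms
proof (induction arbitrary: a a' rule: pp_stage.induct)
  case (zero \<alpha> \<epsilon> r)
  interpret A: comm_group A by fact
  interpret B: comm_group B by fact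
  have a: "a \<xi> \<in> carrier A" "a' \<xi> = h (a \<xi>)" if "r \<xi> \<noteq> 0" for \<xi>
    using zero that by auto
  have "(\<Otimes>\<^bsub>B\<^esub>\<xi>\<in>{\<xi>. r \<xi> \<noteq> 0}. a' \<xi> [^]\<^bsub>B\<^esub> r \<xi>)
      = (\<Otimes>\<^bsub>B\<^esub>\<xi>\<in>{\<xi>. r \<xi> \<noteq> 0}. h (a \<xi> [^]\<^bsub>A\<^esub> r \<xi>))"
    using a hom_int_pow[OF zero.prems(3)] hom_in_carrier[OF zero.prems(3)]
    by (intro B.finprod_cong') auto
  also have "\<dots> = h (\<Otimes>\<^bsub>A\<^esub>\<xi>\<in>{\<xi>. r \<xi> \<noteq> 0}. a \<xi> [^]\<^bsub>A\<^esub> r \<xi>)"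
    using zero a by (intro finprod_hom[symmetric]) auto
  also have "\<dots> = \<one>\<^bsub>B\<^esub>"
    using zero hom_one[OF zero.prems(3)] by simp
  finally show ?case by simp
next
  case (succ \<beta> \<alpha> \<epsilon> \<epsilon>' I \<psi>)
  from succ.prems(6) obtain b where b: "\<forall>\<xi><\<epsilon>. b \<xi> = a \<xi>"
    "\<forall>\<xi>. \<epsilon> \<le> \<xi> \<longrightarrow> \<xi> < \<epsilon>' \<longrightarrow> b \<xi> \<in> carrier A" "\<forall>i\<in>I. sat A (\<psi> i) b"
    by auto
  define b' where "b' \<xi> = (if \<xi> < \<epsilon> then a' \<xi> else h (b \<xi>))" for \<xi>
  have bc: "b \<xi> \<in> carrier A" if "\<xi> < \<epsilon>'" for \<xi>
    using b(1,2) succ.prems(4) that by (cases "\<xi> < \<epsilon>") (auto simp: not_less)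
  have "sat B (\<psi> i) b'" if "i \<in> I" for i
  proof -
    have "b' \<xi> = h (b \<xi>)" if "\<xi> < \<epsilon>'" for \<xi>
      using b(1) succ.prems(5) by (simp add: b'_def)
    then show ?thesis
      using succ.IH that succ.prems(1-3) bc b(3) by blast
  qed
  moreover have "b' \<xi> \<in> carrier B" if "\<epsilon> \<le> \<xi>" "\<xi> < \<epsilon>'" for \<xi>
    using that bc hom_in_carrier[OF succ.prems(3)] by (auto simp: b'_def)
  ultimately show ?case
    by (auto simp: b'_def intro!: exI[of _ b'])
qed auto

text \<open>
  The solution set of a pp-formula is a subgroup: the witnesses for a sum are the sums of the
  witnesses.
\<close>

lemma sat_mult:
  assumes "pp_stage \<kappa> \<mu> \<alpha> \<epsilon> \<phi>" "comm_group A"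
    "\<And>\<xi>. \<xi> < \<epsilon> \<Longrightarrow> a \<xi> \<in> carrier A" "\<And>\<xi>. \<xi> < \<epsilon> \<Longrightarrow> b \<xi> \<in> carrier A"
    "\<And>\<xi>. \<xi> < \<epsilon> \<Longrightarrow> c \<xi> = a \<xi> \<otimes>\<^bsub>A\<^esub> b \<xi>" "sat A \<phi> a" "sat A \<phi> b"
  shows "sat A \<phi> c"
  using assms
proof (induction arbitrary: a b c rule: pp_stage.induct)
  case (zero \<alpha> \<epsilon> r)
  interpret A: comm_group A by fact
  have ab: "a \<xi> \<in> carrier A" "b \<xi> \<in> carrier A" "c \<xi> = a \<xi> \<otimes>\<^bsub>A\<^esub> b \<xi>" if "r \<xi> \<noteq> 0" for \<xi>
    using zero that by auto
  have "(\<Otimes>\<^bsub>A\<^esub>\<xi>\<in>{\<xi>. r \<xi> \<noteq> 0}. c \<xi> [^]\<^bsub>A\<^esub> r \<xi>)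
      = (\<Otimes>\<^bsub>A\<^esub>\<xi>\<in>{\<xi>. r \<xi> \<noteq> 0}. a \<xi> [^]\<^bsub>A\<^esub> r \<xi> \<otimes>\<^bsub>A\<^esub> b \<xi> [^]\<^bsub>A\<^esub> r \<xi>)"
    using ab by (intro A.finprod_cong') (auto simp: A.int_pow_distrib)
  also have "\<dots> = \<one>\<^bsub>A\<^esub>"
    using zero ab by (subst A.finprod_multf) auto
  finally show ?case by simp
next
  case (succ \<beta> \<alpha> \<epsilon> \<epsilon>' I \<psi>)
  from succ.prems(5) obtain d where d: "\<forall>\<xi><\<epsilon>. d \<xi> = a \<xi>"
    "\<forall>\<xi>. \<epsilon> \<le> \<xi> \<longrightarrow> \<xi> < \<epsilon>' \<longrightarrow> d \<xi> \<in> carrier A" "\<forall>i\<in>I. sat A (\<psi> i) d"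
    by auto
  from succ.prems(6) obtain e where e: "\<forall>\<xi><\<epsilon>. e \<xi> = b \<xi>"
    "\<forall>\<xi>. \<epsilon> \<le> \<xi> \<longrightarrow> \<xi> < \<epsilon>' \<longrightarrow> e \<xi> \<in> carrier A" "\<forall>i\<in>I. sat A (\<psi> i) e"
    by auto
  define f where "f \<xi> = (if \<xi> < \<epsilon> then c \<xi> else d \<xi> \<otimes>\<^bsub>A\<^esub> e \<xi>)" for \<xi>
  have de: "d \<xi> \<in> carrier A" "e \<xi> \<in> carrier A" if "\<xi> < \<epsilon>'" for \<xi>
    using d(1,2) e(1,2) succ.prems(2,3) that by (cases "\<xi> < \<epsilon>"; auto simp: not_less)+
  interpret A: comm_group A by fact
  have "sat A (\<psi> i) f" if "i \<in> I" for i
  proof -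
    have "f \<xi> = d \<xi> \<otimes>\<^bsub>A\<^esub> e \<xi>" if "\<xi> < \<epsilon>'" for \<xi>
      using d(1) e(1) succ.prems(4) by (simp add: f_def)
    then show ?thesis
      using succ.IH that succ.prems(1) de d(3) e(3) by blast
  qed
  moreover have "f \<xi> \<in> carrier A" if "\<epsilon> \<le> \<xi>" "\<xi> < \<epsilon>'" for \<xi>
    using that de by (auto simp: f_def)
  ultimately show ?case
    by (auto simp: f_def intro!: exI[of _ f])
qed auto

text \<open>
  The decomposition \<open>B = B\<^sub>1 \<oplus> B\<^sub>2\<close> enters through its projections \<open>p\<close> and \<open>q\<close>, which are required
  to decompose \<open>A\<close> into \<open>A\<^sub>1\<close> and \<open>A\<^sub>2\<close>.  If \<open>B \<Turnstile> \<phi>(a)\<close>, project to \<open>B\<^sub>1\<close> and \<open>B\<^sub>2\<close>, descend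
  there to \<open>A\<^sub>1\<close> and \<open>A\<^sub>2\<close>, and add up in \<open>A\<close>.
\<close>

lemma le_Sigma_decomposition:
  assumes \<Sigma>: "\<Sigma> \<subseteq> Lambda_infty"
    and AB1: "(A1, B1) \<in> le_Sigma \<Sigma>" and AB2: "(A2, B2) \<in> le_Sigma \<Sigma>"
    and AB: "A \<in> ZMod" "B \<in> ZMod" "sub_structure A B" "sub_structure A1 A" "sub_structure A2 A"
    and p: "p \<in> hom B B1" "p ` carrier A \<subseteq> carrier A1"
    and q: "q \<in> hom B B2" "q ` carrier A \<subseteq> carrier A2"
    and pq: "\<And>x. x \<in> carrier A \<Longrightarrow> x = p x \<otimes>\<^bsub>A\<^esub> q x"
  shows "(A, B) \<in> le_Sigma \<Sigma>"
proof -
  have Z: "A1 \<in> ZMod" "B1 \<in> ZMod" "A2 \<in> ZMod" "B2 \<in> ZMod"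
    using AB1 AB2 by (auto simp: le_Sigma_def)
  note cg = ZModD(1)[OF Z(1)] ZModD(1)[OF Z(2)] ZModD(1)[OF Z(3)] ZModD(1)[OF Z(4)]
    ZModD(1)[OF AB(1)] ZModD(1)[OF AB(2)]
  note gr = ZModD(2)[OF Z(1)] ZModD(2)[OF Z(3)] ZModD(2)[OF AB(1)] ZModD(2)[OF AB(2)]
  have A12: "carrier A1 \<subseteq> carrier A" "carrier A2 \<subseteq> carrier A" "carrier A \<subseteq> carrier B"
    using AB gr by (auto simp: sub_structure_iff)
  have "sat A \<phi> a \<longleftrightarrow> sat B \<phi> a"
    if \<phi>: "\<phi> \<in> \<Sigma>" and a: "\<forall>\<xi><arity \<phi>. a \<xi> \<in> carrier A" for \<phi> a
  proof
    obtain \<kappa> \<mu> \<alpha> where st: "pp_stage \<kappa> \<mu> \<alpha> (arity \<phi>) \<phi>"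
      using \<phi> \<Sigma> pp_stage_arity by (fastforce simp: Lambda_infty_def)
    show "sat B \<phi> a" if "sat A \<phi> a"
      by (rule sat_hom[OF st cg(5,6) sub_structure_hom[OF gr(3,4) AB(3)] _ _ that]) (use a in auto)
    assume B: "sat B \<phi> a"
    have pa: "\<forall>\<xi><arity \<phi>. p (a \<xi>) \<in> carrier A1" and qa: "\<forall>\<xi><arity \<phi>. q (a \<xi>) \<in> carrier A2"
      using a p(2) q(2) by auto
    have "sat B1 \<phi> (\<lambda>\<xi>. p (a \<xi>))"
      by (rule sat_hom[OF st cg(6,2) p(1) _ _ B]) (use a A12 in auto)
    then have sat1: "sat A1 \<phi> (\<lambda>\<xi>. p (a \<xi>))"
      using AB1 pa \<phi> by (auto simp: le_Sigma_def)
    have 1: "sat A \<phi> (\<lambda>\<xi>. p (a \<xi>))"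
      by (rule sat_hom[OF st cg(1,5) sub_structure_hom[OF gr(1,3) AB(4)] _ _ sat1])
        (use pa in auto)
    have "sat B2 \<phi> (\<lambda>\<xi>. q (a \<xi>))"
      by (rule sat_hom[OF st cg(6,4) q(1) _ _ B]) (use a A12 in auto)
    then have sat2: "sat A2 \<phi> (\<lambda>\<xi>. q (a \<xi>))"
      using AB2 qa \<phi> by (auto simp: le_Sigma_def)
    have 2: "sat A \<phi> (\<lambda>\<xi>. q (a \<xi>))"
      by (rule sat_hom[OF st cg(3,5) sub_structure_hom[OF gr(2,3) AB(5)] _ _ sat2])
        (use qa in auto)
    show "sat A \<phi> a"
      by (rule sat_mult[OF st cg(5) _ _ _ 1 2]) (use a pa qa pq A12 in auto)
  qed
  then show ?thesis
    using AB by (auto simp: le_Sigma_def)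
qed


section \<open>Subgroups of a finite cyclic group\<close>

text \<open>
  The elements of the groups must come from the universe, so \<open>\<int>/n\<close> is transported along an injection
  \<open>f\<close> of its residues.
\<close>

locale cyclic_copy =
  fixes n :: int and f :: "int \<Rightarrow> 'u::wellorder"
  assumes universe: "set_universe TYPE('u)"
    and n_pos: "0 < n"
    and inj: "inj_on f {0..<n}"
begin

text \<open>The residue class of \<open>x\<close>.\<close>

definition elt :: "int \<Rightarrow> 'u" where
  "elt x = f (x mod n)"

text \<open>The subgroup of \<open>\<int>/n\<close> generated by \<open>d\<close>; in particular \<open>mult_of 1\<close> is \<open>\<int>/n\<close>.\<close>

definition mult_of :: "int \<Rightarrow> 'u monoid" where
  "mult_of d = \<lparr>carrier = elt ` {x. d dvd x},
     mult = (\<lambda>u v. if u \<in> elt ` {x. d dvd x} \<and> v \<in> elt ` {x. d dvd x}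
       then elt (inv_into {0..<n} f u + inv_into {0..<n} f v) else undefined), one = elt 0\<rparr>"

lemma elt_eq_iff: "elt x = elt y \<longleftrightarrow> x mod n = y mod n"
  using n_pos inj_onD[OF inj, of "x mod n" "y mod n"] by (auto simp: elt_def)

lemma inv_elt: "inv_into {0..<n} f (elt x) = x mod n"
  using n_pos inj by (simp add: elt_def inv_into_f_f)

lemma carrier_mult_of: "carrier (mult_of d) = elt ` {x. d dvd x}"
  by (simp add: mult_of_def)

lemma carrier_mult_ofE:
  assumes "u \<in> carrier (mult_of d)"
  obtains x where "d dvd x" "u = elt x"
  using assms by (auto simp: carrier_mult_of)

lemma elt_in_carrier: "d dvd n \<Longrightarrow> elt x \<in> carrier (mult_of d) \<longleftrightarrow> d dvd x"
  unfolding carrier_mult_of image_iff elt_eq_iff by (metis dvd_mod_iff mem_Collect_eq)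

lemma mult_elt: "d dvd x \<Longrightarrow> d dvd y \<Longrightarrow> elt x \<otimes>\<^bsub>mult_of d\<^esub> elt y = elt (x + y)"
  by (auto simp: mult_of_def inv_elt elt_eq_iff mod_simps)

lemma mult_of_comm_group: "comm_group (mult_of d)"
proof (rule comm_groupI)
  fix u assume "u \<in> carrier (mult_of d)"
  then obtain x where x: "d dvd x" "u = elt x"
    by (rule carrier_mult_ofE)
  then show "\<one>\<^bsub>mult_of d\<^esub> \<otimes>\<^bsub>mult_of d\<^esub> u = u"
    using mult_elt[of d 0 x] by (simp add: mult_of_def)
  show "\<exists>y\<in>carrier (mult_of d). y \<otimes>\<^bsub>mult_of d\<^esub> u = \<one>\<^bsub>mult_of d\<^esub>"
    using x mult_elt[of d "- x" x]
    by (intro bexI[of _ "elt (- x)"]) (auto simp: carrier_mult_of, simp add: mult_of_def)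
qed (auto simp: carrier_mult_of mult_elt ac_simps, simp add: mult_of_def)

lemma mult_of_ZMod: "mult_of d \<in> ZMod"
proof -
  have "finite (carrier (mult_of d))"
    by (rule finite_subset[of _ "f ` {0..<n}"]) (use n_pos in \<open>auto simp: carrier_mult_of elt_def\<close>)
  then have "small (carrier (mult_of d))"
    using universe ordLess_transitive finite_iff_ordLess_natLeq
    unfolding small_def set_universe_def by blast
  moreover have "u \<otimes>\<^bsub>mult_of d\<^esub> v = undefined"
    if "\<not> (u \<in> carrier (mult_of d) \<and> v \<in> carrier (mult_of d))" for u v
    using that by (auto simp: mult_of_def)
  ultimately show ?thesis
    using mult_of_comm_group by (auto simp: ZMod_def)
qed

lemma pow_elt: "d dvd x \<Longrightarrow> elt x [^]\<^bsub>mult_of d\<^esub> (k::nat) = elt (int k * x)"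
proof (induction k)
  case 0
  then show ?case by (simp add: nat_pow_def mult_of_def)
next
  case (Suc k)
  interpret comm_group "mult_of d" by (rule mult_of_comm_group)
  show ?case
    using Suc mult_elt[of d "int k * x" x] by (simp add: algebra_simps)
qed

lemma sub_structure_mult_of:
  assumes "e dvd d"
  shows "sub_structure (mult_of d) (mult_of e)"
proof -
  have "u \<otimes>\<^bsub>mult_of d\<^esub> v = u \<otimes>\<^bsub>mult_of e\<^esub> v"
    if uv: "u \<in> carrier (mult_of d)" "v \<in> carrier (mult_of d)" for u v
  proof -
    obtain x y where "d dvd x" "d dvd y" "u = elt x" "v = elt y"
      using uv by (auto simp: carrier_mult_of)
    then show ?thesis
      using assms dvd_trans mult_elt[of d x y] mult_elt[of e x y] by metis
  qed
  then show ?thesis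
    using assms dvd_trans ZModD(2)[OF mult_of_ZMod]
    by (fastforce simp: sub_structure_iff carrier_mult_of)
qed

lemma some_div_mult_of:
  assumes "some_div N (mult_of d) (elt a)"
  obtains k x where "k \<in> N" "d dvd x" "(int k * x) mod n = a mod n"
  using assms pow_elt by (auto simp: some_div_def carrier_mult_of elt_eq_iff)

lemma some_div_mult_ofI:
  assumes "k \<in> N" "d dvd x" "(int k * x) mod n = a mod n"
  shows "some_div N (mult_of d) (elt a)"
proof -
  have "elt x [^]\<^bsub>mult_of d\<^esub> k = elt a"
    using assms pow_elt by (simp add: elt_eq_iff)
  then show ?thesis
    using assms by (auto simp: some_div_def carrier_mult_of)
qed

text \<open>
  Multiplication by \<open>c\<close>; the projections of a finite cyclic group onto its primary components are
  of this form.
\<close>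

definition scale :: "int \<Rightarrow> 'u \<Rightarrow> 'u" where
  "scale c u = elt (c * inv_into {0..<n} f u)"

lemma scale_elt: "scale c (elt x) = elt (c * x)"
  by (simp add: scale_def inv_elt elt_eq_iff mod_simps)

lemma scale_image: "e dvd c * d \<Longrightarrow> scale c ` carrier (mult_of d) \<subseteq> carrier (mult_of e)"
  by (auto simp: carrier_mult_of scale_elt intro!: imageI elim!: dvdE)
    (metis dvd_triv_left dvd_mult2 mult.assoc mult.left_commute)

lemma scale_hom:
  assumes "e dvd c * d"
  shows "scale c \<in> hom (mult_of d) (mult_of e)"
proof -
  have "scale c (u \<otimes>\<^bsub>mult_of d\<^esub> v) = scale c u \<otimes>\<^bsub>mult_of e\<^esub> scale c v"
    if uv: "u \<in> carrier (mult_of d)" "v \<in> carrier (mult_of d)" for u v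
  proof -
    obtain x y where "d dvd x" "d dvd y" "u = elt x" "v = elt y"
      using uv by (auto simp: carrier_mult_of)
    moreover from this have "e dvd c * x" "e dvd c * y"
      using assms by (meson dvd_trans mult_dvd_mono dvd_refl)+
    ultimately show ?thesis
      by (simp add: mult_elt scale_elt distrib_left)
  qed
  then show ?thesis
    using scale_image[OF assms] by (auto simp: hom_def)
qed

end

lemma div_rel_not_positive_syntactic:
  assumes "set_universe TYPE('u::wellorder)"
  shows "\<not> positive_syntactic (div_rel {2, 3} :: ('u monoid \<times> 'u monoid) set)"
proof
  assume "positive_syntactic (div_rel {2, 3} :: ('u monoid \<times> 'u monoid) set)"
  then obtain \<Sigma> :: "'u ppf set" where \<Sigma>: "\<Sigma> \<subseteq> Lambda_infty" "div_rel {2, 3} = le_Sigma \<Sigma>"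
    by (auto simp: positive_syntactic_def)
  obtain g :: "nat \<Rightarrow> 'u" where g: "inj g"
    using infinite_countable_subset[OF infinite_universe[OF assms]] by blast
  interpret cyclic_copy 36 "\<lambda>x. g (nat x)"
    by unfold_locales (use assms in \<open>auto simp: inj_on_def inj_eq[OF g]\<close>)
  have "(mult_of 12, mult_of 4) \<in> div_rel {2, 3}"
  proof -
    have "some_div {2, 3} (mult_of 12) a" if a: "a \<in> carrier (mult_of 12)" for a
    proof -
      obtain x where x: "12 dvd x" "a = elt x"
        using a by (rule carrier_mult_ofE)
      from x(1) obtain y where "x = 12 * y" by (rule dvdE)
      then have "12 dvd 2 * x" "(int 2 * (2 * x)) mod 36 = x mod 36"
        using mod_mult_self2[of "12 * y" 36 y] by simp_all
      then show ?thesis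
        unfolding x(2) by (intro some_div_mult_ofI[of 2]) auto
    qed
    then show ?thesis
      by (auto simp: div_rel_def mult_of_ZMod sub_structure_mult_of)
  qed
  moreover have "(mult_of 18, mult_of 9) \<in> div_rel {2, 3}"
  proof -
    have "some_div {2, 3} (mult_of 18) a" if a: "a \<in> carrier (mult_of 18)" for a
    proof -
      obtain x where x: "18 dvd x" "a = elt x"
        using a by (rule carrier_mult_ofE)
      from x(1) obtain y where "x = 18 * y" by (rule dvdE)
      then have "(int 3 * x) mod 36 = x mod 36"
        using mod_mult_self2[of "18 * y" 36 y] by simp
      then show ?thesis
        unfolding x(2) using x(1) by (intro some_div_mult_ofI[of 3]) auto
    qed
    then show ?thesis
      by (auto simp: div_rel_def mult_of_ZMod sub_structure_mult_of)
  qed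
  \<comment> \<open>The projections are the idempotents of \<open>\<int>/36\<close>: \<open>28\<close> is 0 modulo 4 and 1 modulo 9, and \<open>9\<close> is
      1 modulo 4 and 0 modulo 9.\<close>
  ultimately have R: "(mult_of 6, mult_of 1) \<in> div_rel {2, 3}"
    unfolding \<Sigma>(2)
  proof (rule le_Sigma_decomposition[OF \<Sigma>(1), where p = "scale 28" and q = "scale 9"])
    fix u assume "u \<in> carrier (mult_of 6)"
    then obtain x where x: "6 dvd x" "u = elt x"
      by (rule carrier_mult_ofE)
    then have "scale 28 u \<otimes>\<^bsub>mult_of 6\<^esub> scale 9 u = elt (28 * x + 9 * x)"
      by (simp add: scale_elt mult_elt)
    also have "\<dots> = u"
      using x mod_mult_self2[of x 36 x] by (simp add: elt_eq_iff)
    finally show "u = scale 28 u \<otimes>\<^bsub>mult_of 6\<^esub> scale 9 u" ..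
  qed (auto intro!: mult_of_ZMod sub_structure_mult_of scale_hom scale_image)
  have "some_div {2, 3} (mult_of 1) (elt 6)"
    by (rule some_div_mult_ofI[of 2 _ _ 3]) auto
  then have "some_div {2, 3} (mult_of 6) (elt 6)"
    using R by (auto simp: div_rel_def elt_in_carrier)
  then obtain k x where k: "k \<in> {2, 3::nat}" "6 dvd x" "(int k * x) mod 36 = 6 mod 36"
    by (rule some_div_mult_of)
  then obtain y z where "x = 6 * y" "int k * x - 6 = 36 * z"
    unfolding mod_eq_dvd_iff by (auto elim!: dvdE)
  then have "int k * y = 1 + 6 * z"
    by (simp add: algebra_simps)
  then show False
    using k(1) by auto presburger+
qed

theorem theorem5p5:
  assumes "set_universe TYPE('u::wellorder)"
  shows "\<exists>R \<in> (LZ1 :: ('u monoid \<times> 'u monoid) set set). \<not> positive_syntactic R"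
  using div_rel_LZ1[OF assms] div_rel_not_positive_syntactic[OF assms] by blast

end
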